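(* Let $D$ be the orientation of the path on ten vertices $v_1, v_2, \dots, v_{10}$ (with underlying edges $\{v_i, v_{i+1}\}$, $1 \le i \le 9$) whose arc set is $$\{\overrightarrow{v_1v_2},\ \overrightarrow{v_3v_2},\ \overrightarrow{v_3v_4},\ \overrightarrow{v_5v_4},\ \overrightarrow{v_5v_6},\ \overrightarrow{v_7v_6},\ \overrightarrow{v_7v_8},\ \overrightarrow{v_9v_8},\ \overrightarrow{v_9v_{10}}\}.$$ Then $D$ has no $(2,3)$-cordial labeling, i.e. $D$ is not $(2,3)$-cordial.
   Context: $\overrightarrow{uv}$ denotes an arc going from $u$ to $v$. A digraph is digon-free if it contains no directed $2$-cycle. A labeling $f:V\to\{0,1\}$ of a finite vertex set is friendly if it is surjective and $\big||f^{-1}(0)|-|f^{-1}(1)|\big|\le 1$. Given a digon-free digraph $D=(V,A)$ and a labeling $f:V\to\{0,1\}$, the induced arc labeling is $g:A\to\{-1,0,1\}$, $g(\overrightarrow{uv})=f(v)-f(u)$. A $(2,3)$-cordial labeling of $D$ is a friendly labeling $f$ whose induced arc labeling $g$ satisfies $-1\le |g^{-1}(i)|-|g^{-1}(j)|\le 1$ for all $i,j\in\{-1,0,1\}$. $D$ is $(2,3)$-cordial if it possesses a $(2,3)$-cordial labeling. *)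

theory Defs
  imports "Graph_Theory.Pair_Digraph"
begin

text \<open>
  In a pair digraph the pair \<^term>\<open>(u, v)\<close> is the arc from \<^term>\<open>u\<close> to \<^term>\<open>v\<close>.
\<close>

locale digon_free_digraph = pair_digraph +
  assumes no_digons: "(u, v) \<in> parcs G \<Longrightarrow> (v, u) \<notin> parcs G"

text \<open>
  A labeling \<open>V \<rightarrow> {0, 1}\<close> is a total function of which only the values on the
  vertex set matter.  Labels are integers because arc labels are their differences.
\<close>

definition friendly :: "'a set \<Rightarrow> ('a \<Rightarrow> int) \<Rightarrow> bool" where
  "friendly V f \<longleftrightarrow>
     f \<in> V \<rightarrow> {0, 1} \<and> f ` V = {0, 1} \<and>
     \<bar>int (card {v \<in> V. f v = 0}) - int (card {v \<in> V. f v = 1})\<bar> \<le> 1"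

definition arc_label :: "('a \<Rightarrow> int) \<Rightarrow> 'a \<times> 'a \<Rightarrow> int" where
  "arc_label f = (\<lambda>(u, v). f v - f u)"

definition cordial_labeling :: "'a pair_pre_digraph \<Rightarrow> ('a \<Rightarrow> int) \<Rightarrow> bool" where
  "cordial_labeling D f \<longleftrightarrow>
     friendly (pverts D) f \<and>
     (\<forall>i\<in>{-1, 0, 1}. \<forall>j\<in>{-1, 0, 1}.
        int (card {e \<in> parcs D. arc_label f e = i})
          - int (card {e \<in> parcs D. arc_label f e = j}) \<in> {-1..1})"

text \<open>
  Meant for digon-free digraphs.  That condition is not a conjunct here, since it
  would make every other digraph non-cordial.
\<close>

definition cordial :: "'a pair_pre_digraph \<Rightarrow> bool" where
  "cordial D \<longleftrightarrow> (\<exists>f. cordial_labeling D f)"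

text \<open>The vertex \<open>v\<^sub>i\<close> is the number \<open>i\<close>.\<close>

definition path10 :: "nat pair_pre_digraph" where
  "path10 = \<lparr>pverts = {1..10},
     parcs = {(1, 2), (3, 2), (3, 4), (5, 4), (5, 6), (7, 6), (7, 8), (9, 8), (9, 10)}\<rparr>"

lemma digon_free_path10: "digon_free_digraph path10"
  by unfold_locales (auto simp: path10_def)

lemma underlying_edges_path10:
  "(\<lambda>(u, v). {u, v}) ` parcs path10 = (\<lambda>i. {i, i + 1}) ` {1..9}"
proof -
  have "{1..9::nat} = {1, 2, 3, 4, 5, 6, 7, 8, 9}"
    by auto
  then show ?thesis
    by (simp add: path10_def insert_commute eval_nat_numeral)
qed

end

theory Submission
  imports Defs
begin

text \<open>
  In \<^const>\<open>path10\<close> every arc goes from an odd to an even vertex.  So in the sum of all arc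
  labels each inner vertex contributes its label twice, with positive sign if it is even and
  negative sign if it is odd, while the two ends contribute theirs only once.  If \<open>E\<close> and
  \<open>O\<close> are the label sums over the even and the odd vertices, the sum of the arc labels is
  \<open>2 * (E - O) + f 1 - f 10\<close>.

  A cordial labeling splits the ten vertices evenly, so \<open>E + O = 5\<close>, and it splits the nine
  arcs evenly, so the labels \<open>1\<close> and \<open>-1\<close> occur equally often and the sum of the arc labels
  is \<open>0\<close>.  Hence \<open>f 1 - f 10\<close> is even; as it lies between \<open>-1\<close> and \<open>1\<close>, it is \<open>0\<close>.  This gives
  \<open>E = O\<close>, which is impossible because \<open>E + O\<close> is odd.
\<close>

lemma sum_eq_card_pos_minus_card_neg:
  fixes h :: "'a \<Rightarrow> int"
  assumes "finite S" and "h \<in> S \<rightarrow> {-1, 0, 1}"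
  shows "sum h S = int (card {x \<in> S. h x = 1}) - int (card {x \<in> S. h x = -1})"
proof -
  have "sum h S = (\<Sum>x\<in>S. of_bool (h x = 1) - of_bool (h x = -1))"
    using assms(2) by (intro sum.cong) (auto simp: Pi_iff)
  also have "\<dots> = int (card {x \<in> S. h x = 1}) - int (card {x \<in> S. h x = -1})"
    using assms(1) by (simp add: sum_subtractf Int_def)
  finally show ?thesis .
qed

lemma sum_card_fibers:
  assumes "finite S" and "finite T" and "h \<in> S \<rightarrow> T"
  shows "(\<Sum>t\<in>T. card {x \<in> S. h x = t}) = card S"
  using sum.group[of S T h "\<lambda>_. 1 :: nat"] assms by (simp add: image_subset_iff_funcset)

theorem mainTheorem1:
  shows "\<not> cordial path10"
proof
  assume "cordial path10"
  then obtain f where lab: "cordial_labeling path10 f"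
    by (auto simp: cordial_def)
  define V where "V = pverts path10"
  define A where "A = parcs path10"
  have V: "V = {1, 2, 3, 4, 5, 6, 7, 8, 9, 10}"
  proof -
    have "{1..10::nat} = insert 10 {1..9}" "{1..9::nat} = {1, 2, 3, 4, 5, 6, 7, 8, 9}"
      by auto
    then show ?thesis
      by (simp add: V_def path10_def insert_commute)
  qed
  have A: "A = {(1, 2), (3, 2), (3, 4), (5, 4), (5, 6), (7, 6), (7, 8), (9, 8), (9, 10)}"
    by (simp add: A_def path10_def)
  have fin: "finite V" "finite A" and cards: "card V = 10" "card A = 9"
    by (simp_all add: V A)
  have f01: "f \<in> V \<rightarrow> {0, 1}"
    and bal_V: "\<bar>int (card {v \<in> V. f v = 0}) - int (card {v \<in> V. f v = 1})\<bar> \<le> 1"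
    using lab by (simp_all add: cordial_labeling_def friendly_def V_def)
  have g: "arc_label f \<in> A \<rightarrow> {-1, 0, 1}"
  proof
    fix e assume "e \<in> A"
    then have "fst e \<in> V" "snd e \<in> V"
      unfolding V A by auto
    from this[THEN funcset_mem[OF f01]] show "arc_label f e \<in> {-1, 0, 1}"
      by (auto simp: arc_label_def case_prod_beta)
  qed

  have "card {v \<in> V. f v = 0} + card {v \<in> V. f v = 1} = 10"
    using sum_card_fibers[OF fin(1) _ f01] cards by simp
  with bal_V have "card {v \<in> V. f v = 1} = 5"
    by linarith
  moreover have "{v \<in> V. f v = -1} = {}"
    using f01 by (auto simp: Pi_iff)
  then have "card {v \<in> V. f v = -1} = 0"
    by (simp only: card.empty)
  moreover have "f \<in> V \<rightarrow> {-1, 0, 1}"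
    using f01 by (auto simp: Pi_iff)
  note sum_eq_card_pos_minus_card_neg[OF fin(1) this]
  ultimately have "sum f V = 5"
    by linarith
  moreover define even_sum where "even_sum = f 2 + f 4 + f 6 + f 8 + f 10"
  moreover define odd_sum where "odd_sum = f 1 + f 3 + f 5 + f 7 + f 9"
  ultimately have vsum: "even_sum + odd_sum = 5"
    by (simp add: V)

  define c where "c i = int (card {e \<in> A. arc_label f e = i})" for i
  have "c (-1) + c 0 + c 1 = 9"
    using sum_card_fibers[OF fin(2) _ g] cards by (simp add: c_def)
  moreover have "c i - c j \<in> {-1..1}" if "i \<in> {-1, 0, 1}" "j \<in> {-1, 0, 1}" for i j
    using lab that unfolding cordial_labeling_def A_def c_def by blast
  from this[of 1 0] this[of 1 "-1"] this[of 0 "-1"] have "\<bar>c 1 - c 0\<bar> \<le> 1" "\<bar>c 1 - c (-1)\<bar> \<le> 1" "\<bar>c 0 - c (-1)\<bar> \<le> 1"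
    by auto
  \<comment> \<open>Nine is a multiple of three, so almost equal counts are equal.\<close>
  ultimately have "c 1 = c (-1)"
    by (smt (verit))
  then have "sum (arc_label f) A = 0"
    using sum_eq_card_pos_minus_card_neg[OF fin(2) g] by (simp add: c_def)
  then have "2 * (even_sum - odd_sum) + f 1 - f 10 = 0"
    by (simp add: A arc_label_def even_sum_def odd_sum_def)
  moreover have "f 1 \<in> {0, 1}" "f 10 \<in> {0, 1}"
    using f01 by (simp_all add: V)
  then have "\<bar>f 1 - f 10\<bar> \<le> 1"
    by auto
  ultimately have "even_sum = odd_sum"
    by (smt (verit))
  with vsum show False
    by presburger
qed

end
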